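(* Let $H$ be a Hopf algebra over a field $F$ generated as an algebra by a Hopf subalgebra $\tilde H$ and a skew-primitive element $v\in H$, $\Delta v=g_1\otimes v+v\otimes g_2$, $g_1,g_2\in G(\tilde H)$. Suppose that there exists an algebra automorphism $\varphi\colon\tilde H\to\tilde H$ such that $vh-\varphi(h)v\in\tilde H$ for all $h\in\tilde H$. Let $A$ be a finite dimensional $H$-simple associative $H$-module algebra with $J^{\tilde H}(A)\neq0$. Let $p$ be the natural number such that $J^{\tilde H}(A)^p=0$ and $J^{\tilde H}(A)^{p-1}\neq0$. Let $\tilde J\subseteq J^{\tilde H}(A)^{p-1}$ be a minimal two-sided $\tilde H$-invariant ideal of $A$. Then there exists $m\in\mathbb N$ such that the sums $$I_k:=\bigoplus_{i=0}^{k-1}v^i\tilde J$$ are direct and are two-sided $\tilde H$-invariant ideals of $A$ for $1\leqslant k\leqslant m$, $I_m=A$, and $I_{m-1}=J^{\tilde H}(A)$. Moreover, the map $v^k\tilde J\to v^{k+1}\tilde J$, $a\mapsto va$, is an $F$-linear bijection for all $0\leqslant k\leqslant m-2$. In addition, $A/J^{\tilde H}(A)$ is an $\tilde H$-simple algebra.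
   Context: An algebra $A$ (not necessarily unital) is an $H$-module algebra for a Hopf algebra $H$ if it is a left $H$-module with $h(ab)=(h_{(1)}a)(h_{(2)}b)$ (Sweedler notation) for all $h\in H$, $a,b\in A$. By restriction, $A$ is also an $\tilde H$-module algebra. A subspace is $H$-invariant if it is an $H$-submodule (similarly for $\tilde H$). $A$ is $H$-simple if $A^2\ne0$ and $A$ has no non-trivial two-sided $H$-invariant ideals (similarly for $\tilde H$). $J^{\tilde H}(A)$ is the maximal nilpotent $\tilde H$-invariant two-sided ideal of $A$. "Minimal" means minimal among nonzero two-sided $\tilde H$-invariant ideals. $G(\tilde H)$ is the group of group-like elements of $\tilde H$. *)

theory Defs
  imports Complex_Main "HOL-Library.Multiset" "HOL-Library.Set_Algebras"
begin

text \<open>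
  A finite multiset \<open>{#(x\<^sub>1, y\<^sub>1), \<dots>, (x\<^sub>n, y\<^sub>n)#}\<close> stands for the formal sum
  \<open>x\<^sub>1 \<otimes> y\<^sub>1 + \<dots> + x\<^sub>n \<otimes> y\<^sub>n\<close>.  The space \<open>V \<otimes> V\<close> is the free commutative monoid on
  \<open>V \<times> V\<close> modulo the congruence generated by the bilinearity relations; its elements are
  equivalence classes of multisets, and \<open>tensor2 scale X\<close> is the class of \<open>X\<close>.  (The quotient
  is a group because \<open>(-x) \<otimes> y\<close> is the negative of \<open>x \<otimes> y\<close>.)  Likewise for \<open>V \<otimes> V \<otimes> V\<close>.
\<close>

inductive mset_cong :: "('t multiset \<Rightarrow> 't multiset \<Rightarrow> bool) \<Rightarrow> 't multiset \<Rightarrow> 't multiset \<Rightarrow> bool"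
  for R where
  base: "R X Y \<Longrightarrow> mset_cong R X Y"
| refl: "mset_cong R X X"
| sym: "mset_cong R X Y \<Longrightarrow> mset_cong R Y X"
| trans: "mset_cong R X Y \<Longrightarrow> mset_cong R Y Z \<Longrightarrow> mset_cong R X Z"
| add: "mset_cong R X Y \<Longrightarrow> mset_cong R (X + Z) (Y + Z)"

inductive bilinear_rel ::
  "('f::field \<Rightarrow> 'v::ab_group_add \<Rightarrow> 'v) \<Rightarrow> ('v \<times> 'v) multiset \<Rightarrow> ('v \<times> 'v) multiset \<Rightarrow> bool"
  for scale where
  zero: "bilinear_rel scale {#(0, y)#} {#}"
| add1: "bilinear_rel scale {#(x + x', y)#} {#(x, y), (x', y)#}"
| add2: "bilinear_rel scale {#(x, y + y')#} {#(x, y), (x, y')#}"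
| scale: "bilinear_rel scale {#(scale c x, y)#} {#(x, scale c y)#}"

inductive trilinear_rel ::
  "('f::field \<Rightarrow> 'v::ab_group_add \<Rightarrow> 'v) \<Rightarrow>
   ('v \<times> 'v \<times> 'v) multiset \<Rightarrow> ('v \<times> 'v \<times> 'v) multiset \<Rightarrow> bool"
  for scale where
  zero: "trilinear_rel scale {#(0, y, z)#} {#}"
| add1: "trilinear_rel scale {#(x + x', y, z)#} {#(x, y, z), (x', y, z)#}"
| add2: "trilinear_rel scale {#(x, y + y', z)#} {#(x, y, z), (x, y', z)#}"
| add3: "trilinear_rel scale {#(x, y, z + z')#} {#(x, y, z), (x, y, z')#}"
| scale12: "trilinear_rel scale {#(scale c x, y, z)#} {#(x, scale c y, z)#}"
| scale23: "trilinear_rel scale {#(x, scale c y, z)#} {#(x, y, scale c z)#}"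

definition tensor2 ::
  "('f::field \<Rightarrow> 'v::ab_group_add \<Rightarrow> 'v) \<Rightarrow> ('v \<times> 'v) multiset \<Rightarrow> ('v \<times> 'v) multiset set" where
  "tensor2 scale X = {Y. mset_cong (bilinear_rel scale) X Y}"

definition tensor3 ::
  "('f::field \<Rightarrow> 'v::ab_group_add \<Rightarrow> 'v) \<Rightarrow>
   ('v \<times> 'v \<times> 'v) multiset \<Rightarrow> ('v \<times> 'v \<times> 'v) multiset set" where
  "tensor3 scale X = {Y. mset_cong (trilinear_rel scale) X Y}"

locale assoc_algebra = vector_space scale
  for scale :: "'f::field \<Rightarrow> 'a::ring \<Rightarrow> 'a" +
  assumes scale_mult_left: "scale c x * y = scale c (x * y)"
    and scale_mult_right: "x * scale c y = scale c (x * y)"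

text \<open>
  \<open>\<Delta> h\<close> is an element of \<open>H \<otimes> H\<close>, i.e. a class of formal sums, and \<open>X \<in> \<Delta> h\<close> says that the
  formal sum \<open>X\<close> represents it: \<open>h\<^sub>(\<^sub>1\<^sub>) \<otimes> h\<^sub>(\<^sub>2\<^sub>) = \<Sum>(x, y)\<in>#X. x \<otimes> y\<close>.
  In \<open>coassoc\<close> the function \<open>D\<close> chooses a representative of each \<open>\<Delta> x\<close>.
\<close>

locale hopf_algebra = assoc_algebra scale
  for scale :: "'f::field \<Rightarrow> 'h::ring_1 \<Rightarrow> 'h" +
  fixes \<Delta> :: "'h \<Rightarrow> ('h \<times> 'h) multiset set"
    and \<epsilon> :: "'h \<Rightarrow> 'f"
    and S :: "'h \<Rightarrow> 'h"
  assumes comult_tensor: "\<Delta> h \<in> range (tensor2 scale)"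
    and comult_add: "X \<in> \<Delta> h \<Longrightarrow> Y \<in> \<Delta> k \<Longrightarrow> \<Delta> (h + k) = tensor2 scale (X + Y)"
    and comult_scale:
      "X \<in> \<Delta> h \<Longrightarrow> \<Delta> (scale c h) = tensor2 scale (image_mset (\<lambda>(x, y). (scale c x, y)) X)"
    and comult_mult:
      "X \<in> \<Delta> h \<Longrightarrow> Y \<in> \<Delta> k \<Longrightarrow>
        \<Delta> (h * k) =
          tensor2 scale (\<Sum>(x, y)\<in>#X. image_mset (\<lambda>(x', y'). (x * x', y * y')) Y)"
    and comult_one: "\<Delta> 1 = tensor2 scale {#(1, 1)#}"
    and counit_linear: "Vector_Spaces.linear scale (*) \<epsilon>"
    and counit_mult: "\<epsilon> (h * k) = \<epsilon> h * \<epsilon> k"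
    and counit_one: "\<epsilon> 1 = 1"
    and coassoc:
      "X \<in> \<Delta> h \<Longrightarrow> (\<And>x. D x \<in> \<Delta> x) \<Longrightarrow>
        tensor3 scale (\<Sum>(x, z)\<in>#X. image_mset (\<lambda>(a, b). (a, b, z)) (D x)) =
        tensor3 scale (\<Sum>(x, z)\<in>#X. image_mset (\<lambda>(a, b). (x, a, b)) (D z))"
    and counit_left: "X \<in> \<Delta> h \<Longrightarrow> (\<Sum>(x, y)\<in>#X. scale (\<epsilon> x) y) = h"
    and counit_right: "X \<in> \<Delta> h \<Longrightarrow> (\<Sum>(x, y)\<in>#X. scale (\<epsilon> y) x) = h"
    and antipode_linear: "Vector_Spaces.linear scale scale S"
    and antipode_left: "X \<in> \<Delta> h \<Longrightarrow> (\<Sum>(x, y)\<in>#X. S x * y) = scale (\<epsilon> h) 1"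
    and antipode_right: "X \<in> \<Delta> h \<Longrightarrow> (\<Sum>(x, y)\<in>#X. x * S y) = scale (\<epsilon> h) 1"

definition subalgebra :: "('f::field \<Rightarrow> 'h::ring_1 \<Rightarrow> 'h) \<Rightarrow> 'h set \<Rightarrow> bool" where
  "subalgebra scale K \<longleftrightarrow>
     module.subspace scale K \<and> 1 \<in> K \<and> (\<forall>x\<in>K. \<forall>y\<in>K. x * y \<in> K)"

definition hopf_subalgebra ::
  "('f::field \<Rightarrow> 'h::ring_1 \<Rightarrow> 'h) \<Rightarrow> ('h \<Rightarrow> ('h \<times> 'h) multiset set) \<Rightarrow> ('h \<Rightarrow> 'h) \<Rightarrow> 'h set \<Rightarrow> bool"
  where
  "hopf_subalgebra scale \<Delta> S K \<longleftrightarrow>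
     subalgebra scale K \<and>
     (\<forall>h\<in>K. \<exists>X\<in>\<Delta> h. set_mset X \<subseteq> K \<times> K) \<and>
     (\<forall>h\<in>K. S h \<in> K)"

definition group_like ::
  "('f::field \<Rightarrow> 'h::ring_1 \<Rightarrow> 'h) \<Rightarrow> ('h \<Rightarrow> ('h \<times> 'h) multiset set) \<Rightarrow> ('h \<Rightarrow> 'f) \<Rightarrow> 'h \<Rightarrow> bool"
  where
  "group_like scale \<Delta> \<epsilon> g \<longleftrightarrow> \<Delta> g = tensor2 scale {#(g, g)#} \<and> \<epsilon> g = 1"

definition algebra_automorphism_on ::
  "('f::field \<Rightarrow> 'h::ring_1 \<Rightarrow> 'h) \<Rightarrow> 'h set \<Rightarrow> ('h \<Rightarrow> 'h) \<Rightarrow> bool" where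
  "algebra_automorphism_on scale K \<phi> \<longleftrightarrow>
     bij_betw \<phi> K K \<and> \<phi> 1 = 1 \<and>
     (\<forall>x\<in>K. \<forall>y\<in>K. \<phi> (x + y) = \<phi> x + \<phi> y \<and> \<phi> (x * y) = \<phi> x * \<phi> y) \<and>
     (\<forall>c. \<forall>x\<in>K. \<phi> (scale c x) = scale c (\<phi> x))"

locale module_algebra =
  hopf_algebra scale \<Delta> \<epsilon> S + A: assoc_algebra scaleA
  for scale :: "'f::field \<Rightarrow> 'h::ring_1 \<Rightarrow> 'h"
    and \<Delta> :: "'h \<Rightarrow> ('h \<times> 'h) multiset set"
    and \<epsilon> :: "'h \<Rightarrow> 'f"
    and S :: "'h \<Rightarrow> 'h"
    and scaleA :: "'f \<Rightarrow> 'a::ring \<Rightarrow> 'a" +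
  fixes act :: "'h \<Rightarrow> 'a \<Rightarrow> 'a"
  assumes act_add_left: "act (h + k) a = act h a + act k a"
    and act_scale_left: "act (scale c h) a = scaleA c (act h a)"
    and act_linear: "Vector_Spaces.linear scaleA scaleA (act h)"
    and act_one: "act 1 a = a"
    and act_mult: "act (h * k) a = act h (act k a)"
    and act_prod: "X \<in> \<Delta> h \<Longrightarrow> act h (a * b) = (\<Sum>(x, y)\<in>#X. act x a * act y b)"

text \<open>
  Algebras with an action, with explicit carrier, so that the notions below apply verbatim both
  to an algebra living on a whole type and to its quotients.
\<close>

record ('f, 'h, 'a) act_alg =
  acarrier :: "'a set"
  azero :: 'a
  aadd :: "'a \<Rightarrow> 'a \<Rightarrow> 'a"
  amult :: "'a \<Rightarrow> 'a \<Rightarrow> 'a"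
  ascale :: "'f \<Rightarrow> 'a \<Rightarrow> 'a"
  aact :: "'h \<Rightarrow> 'a \<Rightarrow> 'a"

definition act_alg_of ::
  "('f \<Rightarrow> 'a \<Rightarrow> 'a) \<Rightarrow> ('h \<Rightarrow> 'a \<Rightarrow> 'a) \<Rightarrow> ('f::field, 'h, 'a::ring) act_alg" where
  "act_alg_of scaleA act =
     \<lparr>acarrier = UNIV, azero = 0, aadd = (+), amult = (*), ascale = scaleA, aact = act\<rparr>"

definition is_subspace :: "('f, 'h, 'a) act_alg \<Rightarrow> 'a set \<Rightarrow> bool" where
  "is_subspace A U \<longleftrightarrow>
     U \<subseteq> acarrier A \<and> azero A \<in> U \<and>
     (\<forall>x\<in>U. \<forall>y\<in>U. aadd A x y \<in> U) \<and>
     (\<forall>c. \<forall>x\<in>U. ascale A c x \<in> U)"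

definition prod_space :: "('f, 'h, 'a) act_alg \<Rightarrow> 'a set \<Rightarrow> 'a set \<Rightarrow> 'a set" where
  "prod_space A U V = is_subspace A hull {amult A u v | u v. u \<in> U \<and> v \<in> V}"

text \<open>The convention \<open>I\<^sup>0 = A\<close> makes no use of a unit.\<close>

fun ideal_power :: "('f, 'h, 'a) act_alg \<Rightarrow> 'a set \<Rightarrow> nat \<Rightarrow> 'a set" where
  "ideal_power A I 0 = acarrier A"
| "ideal_power A I (Suc 0) = I"
| "ideal_power A I (Suc (Suc n)) = prod_space A (ideal_power A I (Suc n)) I"

definition inv_ideal :: "('f, 'h, 'a) act_alg \<Rightarrow> 'h set \<Rightarrow> 'a set \<Rightarrow> bool" where
  "inv_ideal A K I \<longleftrightarrow>
     is_subspace A I \<and>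
     (\<forall>a\<in>acarrier A. \<forall>x\<in>I. amult A a x \<in> I \<and> amult A x a \<in> I) \<and>
     (\<forall>h\<in>K. \<forall>x\<in>I. aact A h x \<in> I)"

definition inv_simple :: "('f, 'h, 'a) act_alg \<Rightarrow> 'h set \<Rightarrow> bool" where
  "inv_simple A K \<longleftrightarrow>
     prod_space A (acarrier A) (acarrier A) \<noteq> {azero A} \<and>
     (\<forall>I. inv_ideal A K I \<longrightarrow> I = {azero A} \<or> I = acarrier A)"

definition minimal_inv_ideal :: "('f, 'h, 'a) act_alg \<Rightarrow> 'h set \<Rightarrow> 'a set \<Rightarrow> bool" where
  "minimal_inv_ideal A K I \<longleftrightarrow>
     inv_ideal A K I \<and> I \<noteq> {azero A} \<and>
     (\<forall>I'. inv_ideal A K I' \<and> I' \<noteq> {azero A} \<and> I' \<subseteq> I \<longrightarrow> I' = I)"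

definition nilpotent_ideal :: "('f, 'h, 'a) act_alg \<Rightarrow> 'a set \<Rightarrow> bool" where
  "nilpotent_ideal A I \<longleftrightarrow> (\<exists>n\<ge>1. ideal_power A I n = {azero A})"

definition maximal_nilpotent_inv_ideal :: "('f, 'h, 'a) act_alg \<Rightarrow> 'h set \<Rightarrow> 'a set \<Rightarrow> bool" where
  "maximal_nilpotent_inv_ideal A K J \<longleftrightarrow>
     inv_ideal A K J \<and> nilpotent_ideal A J \<and>
     (\<forall>I. inv_ideal A K I \<and> nilpotent_ideal A I \<and> J \<subseteq> I \<longrightarrow> I = J)"

definition acoset :: "('f, 'h, 'a) act_alg \<Rightarrow> 'a set \<Rightarrow> 'a \<Rightarrow> 'a set" where
  "acoset A J a = aadd A a ` J"

text \<open>
  The quotient \<open>A / J\<close>.  For an ideal \<open>J\<close> each of the unions below is a union of equal cosets;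
  the action is meaningful for those operators that leave \<open>J\<close> invariant.
\<close>

definition quotient_alg :: "('f, 'h, 'a) act_alg \<Rightarrow> 'a set \<Rightarrow> ('f, 'h, 'a set) act_alg" where
  "quotient_alg A J =
     \<lparr>acarrier = acoset A J ` acarrier A,
      azero = J,
      aadd = (\<lambda>X Y. \<Union>x\<in>X. \<Union>y\<in>Y. acoset A J (aadd A x y)),
      amult = (\<lambda>X Y. \<Union>x\<in>X. \<Union>y\<in>Y. acoset A J (amult A x y)),
      ascale = (\<lambda>c X. \<Union>x\<in>X. acoset A J (ascale A c x)),
      aact = (\<lambda>h X. \<Union>x\<in>X. acoset A J (aact A h x))\<rparr>"

definition sum_is_direct :: "nat \<Rightarrow> (nat \<Rightarrow> 'a::ab_group_add set) \<Rightarrow> bool" where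
  "sum_is_direct k U \<longleftrightarrow>
     (\<forall>a. (\<forall>i<k. a i \<in> U i) \<and> (\<Sum>i<k. a i) = 0 \<longrightarrow> (\<forall>i<k. a i = 0))"

end

theory Submission
  imports Defs
begin

text \<open>
  Write \<open>I\<^sub>k = \<Sum>i<k. v\<^sup>i Jt\<close>.  Since \<open>g1\<close>, \<open>g2\<close> and \<open>\<phi>\<close> are invertible, the formulas for \<open>v (a b)\<close> and
  \<open>v h\<close> show by induction that every \<open>I\<^sub>k\<close> is an invariant ideal, and that \<open>v\<^sup>k\<close> induces a map
  \<open>Jt \<rightarrow> I\<^sub>k\<^sub>+\<^sub>1 / I\<^sub>k\<close> that respects multiplication and the action up to a twist.  Its kernel is an
  invariant ideal inside \<open>Jt\<close>, so by minimality the map is bijective or \<open>I\<^sub>k\<^sub>+\<^sub>1 = I\<^sub>k\<close>.  In the latter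
  case \<open>I\<^sub>k\<close> is stable under \<open>v\<close>, hence equal to \<open>A\<close>; let \<open>m\<close> be the first such \<open>k\<close>.  Pulling ideals back
  along \<open>v\<^sup>m\<^sup>-\<^sup>1\<close> shows that \<open>M = I\<^sub>m\<^sub>-\<^sub>1\<close> is a maximal invariant ideal.  An invariant ideal \<open>K\<close> with
  \<open>Jt K = 0\<close> satisfies \<open>I\<^sub>k\<^sub>+\<^sub>1 K \<subseteq> I\<^sub>k\<close>.  For \<open>K = J\<close> this gives \<open>A J \<subseteq> M\<close>, whence \<open>J \<subseteq> M\<close> by maximality
  and \<open>A\<^sup>2 = A\<close>.  As \<open>A / M\<close> is a twisted copy of \<open>Jt\<close> and \<open>M\<close> annihilates it, also \<open>Jt M = 0\<close>, so \<open>M\<close>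
  is nilpotent and \<open>M = J\<close>.
\<close>

section \<open>Invariant ideals of an algebra with an action\<close>

lemma act_alg_of_sel [simp]:
  "acarrier (act_alg_of sc act) = UNIV" "azero (act_alg_of sc act) = 0"
  by (simp_all add: act_alg_of_def)

lemma is_subspace_of:
  "is_subspace (act_alg_of sc act) U \<longleftrightarrow>
     0 \<in> U \<and> (\<forall>x\<in>U. \<forall>y\<in>U. x + y \<in> U) \<and> (\<forall>c. \<forall>x\<in>U. sc c x \<in> U)"
  by (simp add: is_subspace_def act_alg_of_def)

lemma inv_ideal_of:
  "inv_ideal (act_alg_of sc act) K I \<longleftrightarrow>
     0 \<in> I \<and> (\<forall>x\<in>I. \<forall>y\<in>I. x + y \<in> I) \<and> (\<forall>c. \<forall>x\<in>I. sc c x \<in> I) \<and>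
     (\<forall>a. \<forall>x\<in>I. a * x \<in> I) \<and> (\<forall>a. \<forall>x\<in>I. x * a \<in> I) \<and> (\<forall>h\<in>K. \<forall>x\<in>I. act h x \<in> I)"
  unfolding inv_ideal_def is_subspace_of by (auto simp: act_alg_of_def)

lemma prod_space_of_subset:
  assumes "is_subspace (act_alg_of sc act) W" "\<And>x y. x \<in> U \<Longrightarrow> y \<in> V \<Longrightarrow> x * y \<in> W"
  shows "prod_space (act_alg_of sc act) U V \<subseteq> W"
  unfolding prod_space_def using assms by (intro hull_minimal) (auto simp: act_alg_of_def)

lemma mult_in_prod_space_of:
  "x \<in> U \<Longrightarrow> y \<in> V \<Longrightarrow> x * y \<in> prod_space (act_alg_of sc act) U V"
  unfolding prod_space_def by (rule hull_inc) (auto simp: act_alg_of_def)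

lemma is_subspace_prod_space_of:
  "is_subspace (act_alg_of sc act) (prod_space (act_alg_of sc act) U V)"
  unfolding prod_space_def hull_def is_subspace_of by auto

context module_algebra
begin

abbreviation "AA \<equiv> act_alg_of scaleA act"

lemma act_hom: "module_hom scaleA scaleA (act h)"
  using act_linear unfolding linear_def by (simp add: Vector_Spaces.linear_def)

lemmas act_add = module_hom.add[OF act_hom]
  and act_scale = module_hom.scale[OF act_hom]
  and act_zero = module_hom.zero[OF act_hom]
  and act_diff = module_hom.diff[OF act_hom]

lemma act_diff_left: "act (h - k) a = act h a - act k a"
  using act_add_left[of "h - k" k a] by (simp add: algebra_simps)

lemma tensor2_self: "X \<in> tensor2 scale X"
  by (simp add: tensor2_def mset_cong.refl)

lemma inv_ideal_uminus:
  assumes "inv_ideal AA K I" "x \<in> I" shows "- x \<in> I"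
proof -
  have "scaleA (- 1) x \<in> I" using assms unfolding inv_ideal_of by blast
  then show ?thesis by simp
qed

lemma inv_ideal_diff:
  assumes "inv_ideal AA K I" "x \<in> I" "y \<in> I" shows "x - y \<in> I"
  using inv_ideal_uminus[OF assms(1,3)] assms(1,2) unfolding inv_ideal_of
  by (metis add_uminus_conv_diff)

lemma inv_ideal_plus:
  assumes "inv_ideal AA K I" "inv_ideal AA K L"
  shows "inv_ideal AA K (I + L)"
proof -
  note d = assms[unfolded inv_ideal_of]
  have f: "f x \<in> I + L"
    if "x \<in> I + L" "\<And>a b. f (a + b) = f a + f b" "\<And>a. a \<in> I \<Longrightarrow> f a \<in> I" "\<And>a. a \<in> L \<Longrightarrow> f a \<in> L"
    for x and f :: "'a \<Rightarrow> 'a"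
    using that by (auto elim!: set_plus_elim intro!: set_plus_intro)
  show ?thesis unfolding inv_ideal_of
  proof (intro conjI ballI allI)
    show "0 \<in> I + L" using d set_plus_intro[of 0 I 0 L] by simp
    show "x + y \<in> I + L" if x: "x \<in> I + L" and y: "y \<in> I + L" for x y
    proof -
      from x y obtain a b a' b' where xy: "x = a + b" "y = a' + b'"
        and ab: "a \<in> I" "a' \<in> I" "b \<in> L" "b' \<in> L"
        by (auto elim!: set_plus_elim)
      have "a + a' \<in> I" "b + b' \<in> L" using ab d by blast+
      then have "(a + a') + (b + b') \<in> I + L" by (rule set_plus_intro)
      moreover have "x + y = (a + a') + (b + b')" unfolding xy by (simp add: algebra_simps)
      ultimately show ?thesis by (simp only:)
    qed
    show "scaleA c x \<in> I + L" if "x \<in> I + L" for c x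
      by (rule f[OF that]) (use d in \<open>auto simp: A.scale_right_distrib\<close>)
    show "c * x \<in> I + L" if "x \<in> I + L" for c x
      by (rule f[OF that]) (use d in \<open>auto simp: distrib_left\<close>)
    show "x * c \<in> I + L" if "x \<in> I + L" for c x
      by (rule f[OF that, where f = "\<lambda>x. x * c"]) (use d in \<open>auto simp: distrib_right\<close>)
    show "act c x \<in> I + L" if "c \<in> K" "x \<in> I + L" for c x
      by (rule f[OF that(2)]) (use d that in \<open>auto simp: act_add\<close>)
  qed
qed

text \<open>The coproduct rewrites \<open>act h (x * y)\<close> as a sum of products, so the
  elements that \<open>act h\<close> sends into the span of all products form a subspace containing
  every product.\<close>

lemma inv_ideal_prod_space_UNIV: "inv_ideal AA UNIV (prod_space AA UNIV UNIV)"
proof -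
  let ?P = "prod_space AA UNIV UNIV"
  have sub: "is_subspace AA ?P" by (rule is_subspace_prod_space_of)
  have m: "x * y \<in> ?P" for x y :: 'a by (rule mult_in_prod_space_of) auto
  have "act h x \<in> ?P" if "x \<in> ?P" for h x
  proof -
    have "act h (x * y) \<in> ?P" for x y
    proof -
      obtain X where "X \<in> \<Delta> h" using comult_tensor[of h] tensor2_self by auto
      then have "act h (x * y) = (\<Sum>(a, b)\<in>#X. act a x * act b y)" by (rule act_prod)
      also have "\<dots> \<in> ?P" using sub m unfolding is_subspace_of by (induction X) auto
      finally show ?thesis .
    qed
    then have "?P \<subseteq> {x. act h x \<in> ?P}" using sub
      by (intro prod_space_of_subset) (auto simp: is_subspace_of act_add act_scale act_zero)
    with that show ?thesis by blast
  qed
  then show ?thesis using sub m unfolding inv_ideal_of is_subspace_of by blast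
qed

lemma inv_simple_prod_space:
  assumes "inv_simple AA UNIV" shows "prod_space AA UNIV UNIV = UNIV"
  using assms inv_ideal_prod_space_UNIV unfolding inv_simple_def by auto

text \<open>Simplicity over the whole Hopf algebra forces \<open>A^2 = A\<close>, which replaces a
  unit. It rules out proper ideals containing all products, even when they are invariant only under
  \<open>K\<close>.\<close>

lemma inv_simple_mult_closed:
  assumes "inv_simple AA UNIV" "inv_ideal AA K I" "\<And>x y. x * y \<in> I"
  shows "I = UNIV"
proof -
  have "prod_space AA UNIV UNIV \<subseteq> I"
    using assms(2,3) by (intro prod_space_of_subset) (auto simp: inv_ideal_of is_subspace_of)
  then show ?thesis using inv_simple_prod_space[OF assms(1)] by auto
qed

section \<open>Cosets of an invariant ideal and simplicity of the quotient\<close>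

lemma in_acoset_iff: "y \<in> acoset AA I x \<longleftrightarrow> y - x \<in> I"
  by (force simp: acoset_def act_alg_of_def image_iff)

lemma acoset_eq:
  assumes I: "inv_ideal AA K I"
  shows "acoset AA I x = acoset AA I y \<longleftrightarrow> x - y \<in> I"
proof
  assume e: "acoset AA I x = acoset AA I y"
  have "x \<in> acoset AA I x" using I by (simp add: inv_ideal_of in_acoset_iff)
  then have "x \<in> acoset AA I y" by (simp only: e)
  then show "x - y \<in> I" by (simp only: in_acoset_iff)
next
  assume xy: "x - y \<in> I"
  have "w - x \<in> I \<longleftrightarrow> w - y \<in> I" for w
  proof
    assume "w - x \<in> I"
    then have "(w - x) + (x - y) \<in> I" using xy I unfolding inv_ideal_of by blast
    then show "w - y \<in> I" by simp
  next
    assume "w - y \<in> I"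
    then have "(w - y) - (x - y) \<in> I" using xy by (rule inv_ideal_diff[OF I])
    then show "w - x \<in> I" by simp
  qed
  then show "acoset AA I x = acoset AA I y" by (simp add: set_eq_iff in_acoset_iff)
qed

text \<open>Ideals of the quotient correspond to their preimages under the coset map, which are
  invariant ideals containing \<open>I\<close>; maximality leaves only the two extreme ones. The
  last assumption provides a nonzero product in the quotient.\<close>

lemma inv_simple_quotient:
  assumes I: "inv_ideal AA K I"
    and maxi: "\<And>L. inv_ideal AA K L \<Longrightarrow> I \<subseteq> L \<Longrightarrow> L = I \<or> L = UNIV"
    and prod: "\<not> (\<forall>x y. x * y \<in> I)"
  shows "inv_simple (quotient_alg AA I) K"
proof -
  let ?Q = "quotient_alg AA I" and ?c = "acoset AA I"
  note Id = I[unfolded inv_ideal_of]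
  have ceq: "?c x = ?c y \<longleftrightarrow> x - y \<in> I" for x y by (rule acoset_eq[OF I])
  have self: "x \<in> ?c x" for x using Id by (simp add: in_acoset_iff)
  have c0: "?c 0 = I" by (auto simp: in_acoset_iff)
  have car: "acarrier ?Q = range ?c" and zero: "azero ?Q = I"
    by (simp_all add: quotient_alg_def act_alg_of_def)
  \<comment> \<open>An operation compatible with congruence modulo \<open>I\<close> turns the
    defining union into a union of equal cosets, so it can be computed on representatives.\<close>
  have un2: "(\<Union>a\<in>?c x. \<Union>b\<in>?c y. ?c (f a b)) = ?c (f x y)"
    if "\<And>a b. a - x \<in> I \<Longrightarrow> b - y \<in> I \<Longrightarrow> f a b - f x y \<in> I" for x y and f :: "'a \<Rightarrow> 'a \<Rightarrow> 'a"
  proof -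
    have "?c (f a b) = ?c (f x y)" if "a \<in> ?c x" "b \<in> ?c y" for a b
      using that \<open>\<And>a b. a - x \<in> I \<Longrightarrow> b - y \<in> I \<Longrightarrow> f a b - f x y \<in> I\<close>
      by (simp add: in_acoset_iff ceq)
    then show ?thesis using self[of x] self[of y] by blast
  qed
  have un1: "(\<Union>a\<in>?c x. ?c (f a)) = ?c (f x)"
    if "\<And>a. a - x \<in> I \<Longrightarrow> f a - f x \<in> I" for x and f :: "'a \<Rightarrow> 'a"
  proof -
    have "?c (f a) = ?c (f x)" if "a \<in> ?c x" for a
      using that \<open>\<And>a. a - x \<in> I \<Longrightarrow> f a - f x \<in> I\<close> by (simp add: in_acoset_iff ceq)
    then show ?thesis using self[of x] by blast
  qed
  have add: "aadd ?Q (?c x) (?c y) = ?c (x + y)" for x y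
  proof -
    have "a + b - (x + y) \<in> I" if "a - x \<in> I" "b - y \<in> I" for a b
    proof -
      have "(a - x) + (b - y) \<in> I" using that Id by blast
      then show ?thesis by (simp add: algebra_simps)
    qed
    from un2[of x y "(+)", OF this] show ?thesis by (simp add: quotient_alg_def act_alg_of_def)
  qed
  have mult: "amult ?Q (?c x) (?c y) = ?c (x * y)" for x y
  proof -
    have "a * b - x * y \<in> I" if "a - x \<in> I" "b - y \<in> I" for a b
    proof -
      have "(a - x) * b + x * (b - y) \<in> I" using that Id by blast
      then show ?thesis by (simp add: algebra_simps)
    qed
    from un2[of x y "(*)", OF this] show ?thesis by (simp add: quotient_alg_def act_alg_of_def)
  qed
  have scl: "ascale ?Q c (?c x) = ?c (scaleA c x)" for c x
  proof -
    have "scaleA c a - scaleA c x \<in> I" if "a - x \<in> I" for a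
      using that Id by (metis A.scale_right_diff_distrib)
    from un1[of x "scaleA c", OF this] show ?thesis by (simp add: quotient_alg_def act_alg_of_def)
  qed
  have ac: "aact ?Q h (?c x) = ?c (act h x)" if "h \<in> K" for h x
  proof -
    have "act h a - act h x \<in> I" if "a - x \<in> I" for a
      using that \<open>h \<in> K\<close> Id by (metis act_diff)
    from un1[of x "act h", OF this] show ?thesis by (simp add: quotient_alg_def act_alg_of_def)
  qed
  have "L = {I} \<or> L = range ?c" if L: "inv_ideal ?Q K L" for L
  proof -
    let ?P = "{x. ?c x \<in> L}"
    have "L \<subseteq> range ?c" using L by (auto simp: inv_ideal_def is_subspace_def car)
    then have LP: "L = ?c ` ?P" by auto
    note Ld = L[unfolded inv_ideal_def is_subspace_def car zero]
    have IL: "I \<in> L" using Ld by blast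
    have "inv_ideal AA K ?P"
      unfolding inv_ideal_of
    proof (intro conjI ballI allI)
      show "0 \<in> ?P" using IL c0 by simp
      show "x + y \<in> ?P" if "x \<in> ?P" "y \<in> ?P" for x y
        using that Ld add[of x y] by (metis mem_Collect_eq)
      show "scaleA c x \<in> ?P" if "x \<in> ?P" for c x
        using that Ld scl[of c x] by (metis mem_Collect_eq)
      show "a * x \<in> ?P" if "x \<in> ?P" for a x
        using that Ld mult[of a x] by (metis mem_Collect_eq rangeI)
      show "x * a \<in> ?P" if "x \<in> ?P" for a x
        using that Ld mult[of x a] by (metis mem_Collect_eq rangeI)
      show "act h x \<in> ?P" if "h \<in> K" "x \<in> ?P" for h x
        using that Ld ac[of h x] by (metis mem_Collect_eq)
    qed
    moreover have "I \<subseteq> ?P"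
    proof
      fix x assume "x \<in> I"
      then have "?c x = I" using ceq[of x 0] c0 by simp
      then show "x \<in> ?P" using IL by simp
    qed
    ultimately consider "?P = I" | "?P = UNIV" using maxi by blast
    then show ?thesis
    proof cases
      case 1
      have "?c x = I" if "x \<in> I" for x using that ceq[of x 0] c0 by simp
      then have "?c ` I = {I}" using Id by blast
      then show ?thesis using LP 1 by simp
    next
      case 2
      then show ?thesis using LP by simp
    qed
  qed
  moreover have "prod_space ?Q (acarrier ?Q) (acarrier ?Q) \<noteq> {azero ?Q}"
  proof
    assume e: "prod_space ?Q (acarrier ?Q) (acarrier ?Q) = {azero ?Q}"
    have "x * y \<in> I" for x y
    proof -
      have "amult ?Q (?c x) (?c y) \<in> prod_space ?Q (acarrier ?Q) (acarrier ?Q)"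
        unfolding prod_space_def by (rule hull_inc) (auto simp: car)
      then show ?thesis using e zero mult ceq[of "x * y" 0] c0 by simp
    qed
    then show False using prod by blast
  qed
  ultimately show ?thesis unfolding inv_simple_def car zero by blast
qed

end

section \<open>The filtration generated by a skew-primitive element\<close>

locale skew_primitive_extension =
  module_algebra scale \<Delta> \<epsilon> S scaleA act
  for scale :: "'f::field \<Rightarrow> 'h::ring_1 \<Rightarrow> 'h" and \<Delta> \<epsilon> S
    and scaleA :: "'f \<Rightarrow> 'a::ring \<Rightarrow> 'a" and act +
  fixes Ht :: "'h set" and v g1 g2 :: 'h and \<phi> :: "'h \<Rightarrow> 'h"
  assumes sub: "hopf_subalgebra scale \<Delta> S Ht"
    and generated: "subalgebra scale hull (insert v Ht) = UNIV"
    and g1: "g1 \<in> Ht" "group_like scale \<Delta> \<epsilon> g1"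
    and g2: "g2 \<in> Ht" "group_like scale \<Delta> \<epsilon> g2"
    and skew_primitive: "\<Delta> v = tensor2 scale {#(g1, v), (v, g2)#}"
    and automorphism: "algebra_automorphism_on scale Ht \<phi>"
    and commutation: "\<forall>h\<in>Ht. v * h - \<phi> h * v \<in> Ht"
begin

section \<open>Product rule for \<open>v\<close>, inverses of group-likes and commutation with
  \<open>v\<close>\<close>

lemma act_v_mult: "act v (a * b) = act g1 a * act v b + act v a * act g2 b"
  using act_prod[of "{#(g1, v), (v, g2)#}" v a b] tensor2_self skew_primitive by simp

text \<open>For a group-like \<open>g\<close> the antipode axiom reads
  \<open>g * S g = 1\<close>.\<close>

lemma act_group_like_inverse:
  assumes "group_like scale \<Delta> \<epsilon> g"
  shows "act g (act (S g) a) = a"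
proof -
  have "{#(g, g)#} \<in> \<Delta> g" and e: "\<epsilon> g = 1"
    using assms tensor2_self unfolding group_like_def by auto
  then have "g * S g = 1" using antipode_right[of "{#(g, g)#}" g] by simp
  then show ?thesis by (metis act_mult act_one)
qed

lemma phi_in: "h \<in> Ht \<Longrightarrow> \<phi> h \<in> Ht" and phi_surj: "h \<in> Ht \<Longrightarrow> \<exists>h'\<in>Ht. h = \<phi> h'"
  using automorphism unfolding algebra_automorphism_on_def bij_betw_def by auto

lemma funpow_phi_in: "h \<in> Ht \<Longrightarrow> (\<phi> ^^ k) h \<in> Ht"
  by (induction k) (auto simp: phi_in)

lemma act_v_comm: "act v (act h a) = act (\<phi> h) (act v a) + act (v * h - \<phi> h * v) a"
  by (simp add: act_diff_left act_mult)

lemma antipode_in: "h \<in> Ht \<Longrightarrow> S h \<in> Ht"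
  using sub unfolding hopf_subalgebra_def by blast

lemma power_in: "h \<in> Ht \<Longrightarrow> h ^ k \<in> Ht"
  using sub unfolding hopf_subalgebra_def subalgebra_def by (induction k) auto

text \<open>The preimage arises by applying \<open>S g\<close> repeatedly; this stays in
  \<open>I\<close> because the antipode preserves \<open>Ht\<close>.\<close>

lemma act_power_surj:
  assumes "group_like scale \<Delta> \<epsilon> g" "g \<in> Ht" "inv_ideal AA Ht I" "x \<in> I"
  shows "\<exists>y\<in>I. act (g ^ k) y = x"
  using assms(4)
proof (induction k arbitrary: x)
  case 0
  then show ?case by (auto simp: act_one)
next
  case (Suc k)
  have "act (S g) x \<in> I"
    using assms(2,3) Suc.prems antipode_in unfolding inv_ideal_of by blast
  from Suc.IH[OF this] obtain y where "y \<in> I" "act (g ^ k) y = act (S g) x" by blast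
  then show ?case using act_group_like_inverse[OF assms(1)] by (auto simp: act_mult intro!: bexI[of _ y])
qed

text \<open>The elements of the Hopf algebra that map \<open>I\<close> into itself form a
  subalgebra. It contains \<open>v\<close> and \<open>Ht\<close>, hence everything.\<close>

lemma v_stable_imp_inv_ideal_UNIV:
  assumes I: "inv_ideal AA Ht I" and v: "\<And>x. x \<in> I \<Longrightarrow> act v x \<in> I"
  shows "inv_ideal AA UNIV I"
proof -
  let ?K = "{h. \<forall>x\<in>I. act h x \<in> I}"
  have "act 0 a = 0" for a using act_diff_left[of 0 0 a] by simp
  then have "subalgebra scale ?K" using I
    unfolding subalgebra_def subspace_def inv_ideal_of
    by (auto simp: act_one act_mult act_add_left act_scale_left)
  moreover have "insert v Ht \<subseteq> ?K" using I v by (auto simp: inv_ideal_of)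
  ultimately have "?K = UNIV" using hull_minimal[of "insert v Ht" ?K] generated by auto
  then show ?thesis using I unfolding inv_ideal_of by blast
qed

section \<open>The layers \<open>U + v U + ... + v^(k-1) U\<close>\<close>

definition layers :: "'a set \<Rightarrow> nat \<Rightarrow> 'a set" where
  "layers U k = (\<Sum>i<k. act (v ^ i) ` U)"

lemma layers_0: "layers U 0 = {0}" by (simp add: layers_def)

lemma layers_Suc: "layers U (Suc k) = layers U k + act (v ^ k) ` U"
  by (simp add: layers_def)

lemma layers_1: "layers U (Suc 0) = U"
  by (auto simp: layers_Suc layers_0 act_one)

lemma image_set_plus: "act h ` (X + Y) = act h ` X + act h ` Y"
proof
  show "act h ` (X + Y) \<subseteq> act h ` X + act h ` Y"
    by (auto elim!: set_plus_elim intro!: set_plus_intro simp: act_add)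
  show "act h ` X + act h ` Y \<subseteq> act h ` (X + Y)"
    by (auto elim!: set_plus_elim intro!: imageI set_plus_intro simp flip: act_add)
qed

text \<open>A second recursion that adds \<open>U\<close> at the bottom instead of
  \<open>v^k U\<close> on top. It presents elements of the next layer as \<open>a + act v b\<close>,
  the form to which the product rule and the commutation rule for \<open>v\<close> apply.\<close>

lemma layers_Suc_shift: "layers U (Suc k) = U + act v ` layers U k"
proof (induction k)
  case 0
  show ?case by (auto simp: layers_1 layers_0 act_zero)
next
  case (Suc k)
  have "act v ` act (v ^ k) ` U = act (v ^ Suc k) ` U" by (simp add: image_image act_mult)
  then show ?case
    by (simp only: layers_Suc[of U "Suc k"] layers_Suc[of U k] image_set_plus)
       (simp flip: Suc.IH layers_Suc add: add.assoc[symmetric])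
qed

context
  fixes U assumes U: "inv_ideal AA Ht U"
begin

lemma layers_v: "x \<in> layers U k \<Longrightarrow> act v x \<in> layers U (Suc k)"
  unfolding layers_Suc_shift using U set_plus_intro[of 0 U "act v x" "act v ` layers U k"]
  by (auto simp: inv_ideal_of)

text \<open>Both claims are proved in one induction: solving the rules for \<open>v\<close> leaves
  correction terms in the previous layer, and the inclusion absorbs them into the next one.\<close>

lemma inv_ideal_layers: "inv_ideal AA Ht (layers U k)"
  and layers_mono_Suc: "layers U k \<subseteq> layers U (Suc k)"
proof -
  have "inv_ideal AA Ht (layers U k) \<and> layers U k \<subseteq> layers U (Suc k)"
  proof (induction k)
    case 0
    show ?case using U by (auto simp: layers_0 layers_1 inv_ideal_of act_zero)
  next
    case (Suc k)
    let ?L = "layers U k" and ?M = "layers U (Suc k)"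
    have L: "inv_ideal AA Ht ?L" and LM: "?L \<subseteq> ?M" using Suc by auto
    note Ld = L[unfolded inv_ideal_of] and Ud = U[unfolded inv_ideal_of]
    have M: "?M = U + act v ` ?L" by (rule layers_Suc_shift)
    have add: "x + y \<in> ?M" if xM: "x \<in> ?M" and yM: "y \<in> ?M" for x y
    proof -
      obtain a b where x: "x = a + act v b" "a \<in> U" "b \<in> ?L"
        using xM unfolding M by (auto elim!: set_plus_elim)
      obtain a' b' where y: "y = a' + act v b'" "a' \<in> U" "b' \<in> ?L"
        using yM unfolding M by (auto elim!: set_plus_elim)
      have "x + y = (a + a') + act v (b + b')" using x y by (simp add: act_add algebra_simps)
      moreover have "a + a' \<in> U" "b + b' \<in> ?L" using x y Ld Ud by auto
      ultimately show ?thesis unfolding M by (auto intro!: set_plus_intro)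
    qed
    have UM: "x \<in> ?M" if "x \<in> U" for x
      unfolding M using set_plus_intro[OF that, of 0 "act v ` ?L"] Ld act_zero[of v]
      by (metis add.right_neutral imageI)
    have vM: "act v x \<in> ?M" if "x \<in> ?L" for x using that by (rule layers_v)
    have diff: "x - y \<in> ?M" if "x \<in> ?M" "y \<in> ?L" for x y
      using add[OF that(1), of "- y"] inv_ideal_uminus[OF L that(2)] LM by auto
    \<comment> \<open>Closure under an additive map has to be checked only on \<open>U\<close> and
      on \<open>act v a\<close> with \<open>a\<close> in the previous layer.\<close>
    have ind: "f x \<in> ?M"
      if "x \<in> ?M" "\<And>a b. f (a + b) = f a + f b" "\<And>a. a \<in> U \<Longrightarrow> f a \<in> U"
        "\<And>a. a \<in> ?L \<Longrightarrow> f (act v a) \<in> ?M" for f :: "'a \<Rightarrow> 'a" and x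
    proof -
      obtain a b where "x = a + act v b" "a \<in> U" "b \<in> ?L"
        using \<open>x \<in> ?M\<close> unfolding M by (auto elim!: set_plus_elim)
      then show ?thesis using that(2-4) add UM by metis
    qed
    have "inv_ideal AA Ht ?M"
      unfolding inv_ideal_of
    proof (intro conjI ballI allI)
      show "0 \<in> ?M" using LM Ld by blast
      show "x + y \<in> ?M" if "x \<in> ?M" "y \<in> ?M" for x y using that by (rule add)
      show "scaleA c x \<in> ?M" if "x \<in> ?M" for c x
        by (rule ind[OF that]) (use Ud Ld vM in \<open>auto simp: A.scale_right_distrib simp flip: act_scale\<close>)
      show "c * x \<in> ?M" if "x \<in> ?M" for c x
      proof (rule ind[OF that])
        fix a assume a: "a \<in> ?L"
        \<comment> \<open>Chosen so that \<open>act g1 c' = c\<close>, which allows the product rule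
          to be solved for \<open>c * act v a\<close>. On the right, \<open>g2\<close> plays the
          same role.\<close>
        define c' where "c' = act (S g1) c"
        have "c * act v a = act v (c' * a) - act v c' * act g2 a"
          by (simp add: act_v_mult c'_def act_group_like_inverse[OF g1(2)])
        also have "\<dots> \<in> ?M" using a Ld g2(1) by (intro diff vM) auto
        finally show "c * act v a \<in> ?M" .
      qed (use Ud in \<open>auto simp: distrib_left\<close>)
      show "x * c \<in> ?M" if "x \<in> ?M" for c x
      proof (rule ind[OF that, where f = "\<lambda>x. x * c"])
        fix a assume a: "a \<in> ?L"
        define c' where "c' = act (S g2) c"
        have "act v a * c = act v (a * c') - act g1 a * act v c'"
          by (simp add: act_v_mult c'_def act_group_like_inverse[OF g2(2)])
        also have "\<dots> \<in> ?M" using a Ld g1(1) by (intro diff vM) auto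
        finally show "act v a * c \<in> ?M" .
      qed (use Ud in \<open>auto simp: distrib_right\<close>)
      show "act h x \<in> ?M" if h: "h \<in> Ht" and "x \<in> ?M" for h x
      proof (rule ind[OF that(2)])
        fix a assume a: "a \<in> ?L"
        \<comment> \<open>Surjectivity of \<open>\<phi>\<close> on \<open>Ht\<close> supplies an
          \<open>h'\<close> with \<open>v * h' - h * v\<close> in \<open>Ht\<close>, so
          \<open>h\<close> can be moved past \<open>v\<close>.\<close>
        obtain h' where h': "h' \<in> Ht" "h = \<phi> h'" using phi_surj[OF h] by blast
        have "act h (act v a) = act v (act h' a) - act (v * h' - \<phi> h' * v) a"
          unfolding h'(2) act_v_comm by simp
        also have "\<dots> \<in> ?M" using a Ld h' commutation by (intro diff vM) auto
        finally show "act h (act v a) \<in> ?M" .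
      qed (use Ud h in \<open>auto simp: act_add\<close>)
    qed
    moreover have "?M \<subseteq> layers U (Suc (Suc k))"
      unfolding layers_Suc[of U "Suc k"] using Ud
      by (metis (no_types, lifting) act_zero add.right_neutral image_eqI set_plus_intro subsetI)
    ultimately show ?case by blast
  qed
  then show "inv_ideal AA Ht (layers U k)" "layers U k \<subseteq> layers U (Suc k)" by auto
qed

lemma layers_mono: "i \<le> k \<Longrightarrow> layers U i \<subseteq> layers U k"
  by (rule lift_Suc_mono_le[of "layers U"]) (rule layers_mono_Suc)

lemma layers_power: "a \<in> U \<Longrightarrow> act (v ^ k) a \<in> layers U (Suc k)"
  using inv_ideal_layers[of k] unfolding layers_Suc inv_ideal_of
  by (metis add.left_neutral imageI set_plus_intro)

section \<open>The twisted homomorphism from \<open>U\<close> to successive quotients of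
  layers\<close>

lemma layers_v_mult_diff:
  assumes "x - y \<in> layers U k"
  shows "act v x - act v y \<in> layers U (Suc k)"
  using layers_v[OF assms] by (simp add: act_diff)

text \<open>Applying \<open>v\<close> raises the old error by one layer. The product rule adds only
  \<open>act v ?c * act g2 ?x\<close>, which lies in the ideal \<open>layers U (Suc k)\<close>
  because \<open>?x\<close> does.\<close>

lemma twist_left:
  assumes "a \<in> U"
  shows "act (v ^ k) (c * a) - act (g1 ^ k) c * act (v ^ k) a \<in> layers U k"
proof (induction k)
  case 0
  show ?case by (simp add: act_one layers_0)
next
  case (Suc k)
  let ?x = "act (v ^ k) a" and ?c = "act (g1 ^ k) c" and ?M = "layers U (Suc k)"
  note Md = inv_ideal_layers[of "Suc k", unfolded inv_ideal_of]
  have "act v (act (v ^ k) (c * a)) - act v (?c * ?x) \<in> ?M"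
    by (rule layers_v_mult_diff[OF Suc.IH])
  moreover have "act v ?c * act g2 ?x \<in> ?M" using layers_power[OF assms] Md g2 by blast
  ultimately have
    "act v (act (v ^ k) (c * a)) - act v (?c * ?x) + act v ?c * act g2 ?x \<in> ?M" using Md by blast
  then show ?case by (simp add: act_v_mult act_mult algebra_simps)
qed

lemma twist_right:
  assumes "a \<in> U"
  shows "act (v ^ k) (a * c) - act (v ^ k) a * act (g2 ^ k) c \<in> layers U k"
proof (induction k)
  case 0
  show ?case by (simp add: act_one layers_0)
next
  case (Suc k)
  let ?x = "act (v ^ k) a" and ?c = "act (g2 ^ k) c" and ?M = "layers U (Suc k)"
  note Md = inv_ideal_layers[of "Suc k", unfolded inv_ideal_of]
  have "act v (act (v ^ k) (a * c)) - act v (?x * ?c) \<in> ?M"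
    by (rule layers_v_mult_diff[OF Suc.IH])
  moreover have "act g1 ?x * act v ?c \<in> ?M" using layers_power[OF assms] Md g1 by blast
  ultimately have
    "act v (act (v ^ k) (a * c)) - act v (?x * ?c) + act g1 ?x * act v ?c \<in> ?M" using Md by blast
  then show ?case by (simp add: act_v_mult act_mult algebra_simps)
qed

lemma twist_act:
  assumes "a \<in> U" "h \<in> Ht"
  shows "act (v ^ k) (act h a) - act ((\<phi> ^^ k) h) (act (v ^ k) a) \<in> layers U k"
proof (induction k)
  case 0
  show ?case by (simp add: act_one layers_0)
next
  case (Suc k)
  let ?x = "act (v ^ k) a" and ?h = "(\<phi> ^^ k) h" and ?M = "layers U (Suc k)"
  note Md = inv_ideal_layers[of "Suc k", unfolded inv_ideal_of]
  have "act v (act (v ^ k) (act h a)) - act v (act ?h ?x) \<in> ?M"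
    by (rule layers_v_mult_diff[OF Suc.IH])
  moreover have "act (v * ?h - \<phi> ?h * v) ?x \<in> ?M"
    using layers_power[OF assms(1)] Md funpow_phi_in[OF assms(2)] commutation by blast
  ultimately have "act v (act (v ^ k) (act h a)) - act v (act ?h ?x)
      + act (v * ?h - \<phi> ?h * v) ?x \<in> ?M" using Md by blast
  then show ?case using act_v_comm[of ?h ?x] by (simp add: act_mult algebra_simps)
qed

text \<open>Modulo \<open>layers U k\<close>, hence modulo \<open>K\<close>, multiplying or acting
  before \<open>v^k\<close> amounts to a twisted multiplication or action after it, and
  \<open>K\<close> is closed under these. With \<open>K = layers U k\<close> the set is the kernel
  of the induced map.\<close>

lemma inv_ideal_vpower_vimage:
  assumes K: "inv_ideal AA Ht K" and "layers U k \<subseteq> K"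
  shows "inv_ideal AA Ht {a \<in> U. act (v ^ k) a \<in> K}"
proof -
  note Kd = K[unfolded inv_ideal_of] and Ud = U[unfolded inv_ideal_of]
  have *: "x \<in> K" if "x - y \<in> layers U k" "y \<in> K" for x y
  proof -
    have "(x - y) + y \<in> K" using that assms(2) Kd by blast
    then show ?thesis by simp
  qed
  show ?thesis unfolding inv_ideal_of
    using Ud Kd *[OF twist_left] *[OF twist_right] *[OF twist_act] funpow_phi_in
    by (auto simp: act_zero act_add act_scale)
qed

text \<open>Write \<open>x = a + act v b\<close> and \<open>c = act g2 c'\<close> with
  \<open>c'\<close> in \<open>K\<close>. Then \<open>a * c = 0\<close>, the induction hypothesis
  handles \<open>act v (b * c')\<close>, and the remaining term is controlled through
  \<open>b\<close>, since \<open>act v c'\<close> may leave \<open>K\<close>.\<close>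

lemma layers_mult_right_zero:
  assumes K: "inv_ideal AA Ht K" and UK: "\<And>a c. a \<in> U \<Longrightarrow> c \<in> K \<Longrightarrow> a * c = 0"
    and "x \<in> layers U (Suc k)" "c \<in> K"
  shows "x * c \<in> layers U k"
  using assms(3,4)
proof (induction k arbitrary: x c)
  case 0
  then show ?case using UK by (simp add: layers_1 layers_0)
next
  case (Suc k)
  let ?M = "layers U (Suc k)"
  note Md = inv_ideal_layers[of "Suc k", unfolded inv_ideal_of]
  obtain a b where x: "x = a + act v b" "a \<in> U" "b \<in> ?M"
    using Suc.prems(1) unfolding layers_Suc_shift[of U "Suc k"] by (auto elim!: set_plus_elim)
  obtain c' where c': "c' \<in> K" "act g2 c' = c"
    using act_power_surj[OF g2(2,1) K Suc.prems(2), of 1] by auto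
  have "x * c = act v (b * c') - act g1 b * act v c'"
    using x UK[OF x(2) Suc.prems(2)] c' by (simp add: act_v_mult distrib_right)
  moreover have "act v (b * c') \<in> ?M" using layers_v[OF Suc.IH[OF x(3) c'(1)]] .
  moreover have "act g1 b * act v c' \<in> ?M" using x(3) Md g1(1) by blast
  ultimately show ?case using inv_ideal_diff[OF inv_ideal_layers] by metis
qed

text \<open>Otherwise the dimensions of the layers would increase strictly without bound.\<close>

lemma layers_stabilize:
  assumes "finite_dimensional_vector_space scaleA B"
  shows "\<exists>k. layers U (Suc k) = layers U k"
proof (rule ccontr)
  interpret fd: finite_dimensional_vector_space scaleA B by (rule assms)
  assume "\<not> ?thesis"
  then have ne: "layers U k \<noteq> layers U (Suc k)" for k by metis
  have sub: "A.subspace (layers U k)" for k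
    using inv_ideal_layers[of k] unfolding inv_ideal_of A.subspace_def by blast
  have less: "A.dim (layers U k) < A.dim (layers U (Suc k))" for k
    using fd.subspace_dim_equal[OF sub sub layers_mono_Suc] ne by (meson not_le)
  have "k \<le> A.dim (layers U k)" for k
  proof (induction k)
    case (Suc k)
    then show ?case using less[of k] by linarith
  qed simp
  moreover have "A.dim (layers U k) \<le> A.dim UNIV" for k by (rule fd.dim_subset) simp
  ultimately have "Suc (A.dim UNIV) \<le> A.dim UNIV" by (meson le_trans)
  then show False by simp
qed

end

end

section \<open>The last proper layer is the radical\<close>

theorem theorem3p4:
  fixes scaleH :: "'f::field \<Rightarrow> 'h::ring_1 \<Rightarrow> 'h"
    and \<Delta> :: "'h \<Rightarrow> ('h \<times> 'h) multiset set"
    and \<epsilon> :: "'h \<Rightarrow> 'f"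
    and S :: "'h \<Rightarrow> 'h"
    and Ht :: "'h set"
    and v g1 g2 :: 'h
    and \<phi> :: "'h \<Rightarrow> 'h"
    and scaleA :: "'f \<Rightarrow> 'a::ring \<Rightarrow> 'a"
    and act :: "'h \<Rightarrow> 'a \<Rightarrow> 'a"
    and A :: "('f, 'h, 'a) act_alg"
    and J Jt :: "'a set"
    and p :: nat
  assumes hopf: "hopf_algebra scaleH \<Delta> \<epsilon> S"
    and sub: "hopf_subalgebra scaleH \<Delta> S Ht"
    and generated: "subalgebra scaleH hull (insert v Ht) = UNIV"
    and g1: "g1 \<in> Ht" "group_like scaleH \<Delta> \<epsilon> g1"
    and g2: "g2 \<in> Ht" "group_like scaleH \<Delta> \<epsilon> g2"
    and skew_primitive: "\<Delta> v = tensor2 scaleH {#(g1, v), (v, g2)#}"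
    and automorphism: "algebra_automorphism_on scaleH Ht \<phi>"
    and commutation: "\<forall>h\<in>Ht. v * h - \<phi> h * v \<in> Ht"
    and modalg: "module_algebra scaleH \<Delta> \<epsilon> S scaleA act"
    and A_def: "A = act_alg_of scaleA act"
    and fin_dim: "\<exists>B. finite_dimensional_vector_space scaleA B"
    and H_simple: "inv_simple A (UNIV :: 'h set)"
    and J: "maximal_nilpotent_inv_ideal A Ht J" "J \<noteq> {0}"
    and p: "ideal_power A J p = {0}" "ideal_power A J (p - 1) \<noteq> {0}"
    and Jt: "minimal_inv_ideal A Ht Jt" "Jt \<subseteq> ideal_power A J (p - 1)"
  shows "(\<exists>m\<ge>1.
            (\<forall>k. 1 \<le> k \<and> k \<le> m \<longrightarrow>
               sum_is_direct k (\<lambda>i. act (v ^ i) ` Jt) \<and>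
               inv_ideal A Ht (\<Sum>i<k. act (v ^ i) ` Jt)) \<and>
            (\<Sum>i<m. act (v ^ i) ` Jt) = UNIV \<and>
            (\<Sum>i<m - 1. act (v ^ i) ` Jt) = J \<and>
            Vector_Spaces.linear scaleA scaleA (act v) \<and>
            (\<forall>k. k + 2 \<le> m \<longrightarrow>
               bij_betw (act v) (act (v ^ k) ` Jt) (act (v ^ (k + 1)) ` Jt))) \<and>
         inv_simple (quotient_alg A J) Ht"
proof -
  interpret skew_primitive_extension scaleH \<Delta> \<epsilon> S scaleA act Ht v g1 g2 \<phi>
    by (intro skew_primitive_extension.intro skew_primitive_extension_axioms.intro assms)
  note simple = H_simple[unfolded A_def]
  have Jinv: "inv_ideal AA Ht J"
    and Jmax: "\<And>I. inv_ideal AA Ht I \<Longrightarrow> nilpotent_ideal AA I \<Longrightarrow> J \<subseteq> I \<Longrightarrow> I = J"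
    using J(1) unfolding A_def maximal_nilpotent_inv_ideal_def by auto
  have U: "inv_ideal AA Ht Jt" and U0: "Jt \<noteq> {0}"
    and Umin: "\<And>I. inv_ideal AA Ht I \<Longrightarrow> I \<noteq> {0} \<Longrightarrow> I \<subseteq> Jt \<Longrightarrow> I = Jt"
    using Jt(1) unfolding A_def minimal_inv_ideal_def by auto
  note Ud = U[unfolded inv_ideal_of]
  let ?L = "layers Jt"
  have Linv: "inv_ideal AA Ht (?L k)" for k by (rule inv_ideal_layers[OF U])
  define m where "m = (LEAST k. ?L (Suc k) = ?L k)"
  have ex: "\<exists>k. ?L (Suc k) = ?L k" using fin_dim layers_stabilize[OF U] by blast
  have mfix: "?L (Suc m) = ?L m" unfolding m_def using ex by (rule LeastI_ex)
  have mmin: "?L (Suc k) \<noteq> ?L k" if "k < m" for k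
    using that not_less_Least unfolding m_def by blast
  have "?L (Suc 0) \<noteq> ?L 0" unfolding layers_1 layers_0 by (rule U0)
  then have m1: "m \<ge> 1" using mfix by (metis One_nat_def less_one not_le)
  have JtL: "Jt \<subseteq> ?L m" using layers_mono[OF U m1] by (simp add: layers_1)
  have Lm: "?L m = UNIV"
  proof -
    have "inv_ideal AA UNIV (?L m)"
      using layers_v[OF U, of _ m] mfix by (intro v_stable_imp_inv_ideal_UNIV Linv) auto
    moreover have "?L m \<noteq> {0}" using JtL U0 Ud by blast
    ultimately show ?thesis using simple unfolding inv_simple_def by auto
  qed
  \<comment> \<open>The kernel of the map induced by \<open>v^k\<close> is an invariant ideal inside
    \<open>Jt\<close>. It is not all of \<open>Jt\<close>, since the layers still grow at
    \<open>k < m\<close>, so minimality makes it zero.\<close>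
  have inj: "a = 0" if "k < m" "a \<in> Jt" "act (v ^ k) a \<in> ?L k" for k a
  proof -
    let ?K = "{a \<in> Jt. act (v ^ k) a \<in> ?L k}"
    have K: "inv_ideal AA Ht ?K" by (rule inv_ideal_vpower_vimage[OF U Linv order_refl])
    have "?K \<noteq> Jt"
    proof
      assume "?K = Jt"
      then have "act (v ^ k) ` Jt \<subseteq> ?L k" by blast
      then have "?L (Suc k) \<subseteq> ?L k"
        unfolding layers_Suc using Linv[of k] by (auto elim!: set_plus_elim simp: inv_ideal_of)
      then show False using mmin[OF that(1)] layers_mono_Suc[OF U, of k] by blast
    qed
    then have "?K = {0}" using Umin[OF K] by blast
    then show ?thesis using that by blast
  qed
  let ?M = "?L (m - 1)"
  have Mne: "?M \<noteq> UNIV" using mmin[of "m - 1"] m1 Lm by auto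
  \<comment> \<open>As \<open>A = ?M + v^(m-1) Jt\<close>, an ideal above \<open>?M\<close> is
    determined by its pullback \<open>?T\<close> to \<open>Jt\<close>, and minimality leaves two
    choices for \<open>?T\<close>.\<close>
  have Mmax: "K = ?M \<or> K = UNIV" if K: "inv_ideal AA Ht K" "?M \<subseteq> K" for K
  proof -
    note Kd = K(1)[unfolded inv_ideal_of]
    let ?T = "{a \<in> Jt. act (v ^ (m - 1)) a \<in> K}"
    have T: "inv_ideal AA Ht ?T" by (rule inv_ideal_vpower_vimage[OF U K])
    have dec: "\<exists>y\<in>?M. \<exists>a\<in>Jt. x = y + act (v ^ (m - 1)) a" for x
    proof -
      have "x \<in> ?L (Suc (m - 1))" using Lm m1 by simp
      then show ?thesis unfolding layers_Suc by (auto elim!: set_plus_elim)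
    qed
    show ?thesis
    proof (cases "?T = {0}")
      case True
      have "x \<in> ?M" if x: "x \<in> K" for x
      proof -
        obtain y a where ya: "y \<in> ?M" "a \<in> Jt" "x = y + act (v ^ (m - 1)) a" using dec by blast
        have "x - y \<in> K" using inv_ideal_diff[OF K(1)] x ya K(2) by blast
        then have "a = 0" using ya True by auto
        then show ?thesis using ya by (simp add: act_zero)
      qed
      then show ?thesis using K(2) by blast
    next
      case False
      then have "?T = Jt" using Umin[OF T] by blast
      then have "x \<in> K" for x using dec[of x] K(2) Kd by blast
      then show ?thesis by blast
    qed
  qed
  \<comment> \<open>Truncated subtraction makes \<open>p = 0\<close> contradictory, as
    \<open>p - 1\<close> is then \<open>p\<close>; \<open>p = 1\<close> would give
    \<open>J = {0}\<close>.\<close>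
  have p2: "p \<ge> 2"
  proof -
    have "p \<noteq> p - 1" using p by metis
    moreover have "p \<noteq> Suc 0" using p(1) J(2) by (metis ideal_power.simps(2))
    ultimately show ?thesis by simp
  qed
  have JtJ: "a * c = 0" if "a \<in> Jt" "c \<in> J" for a c
  proof -
    obtain q where q: "p = Suc (Suc q)" using p2 by (metis add_2_eq_Suc le_Suc_ex)
    have "a * c \<in> prod_space AA (ideal_power AA J (Suc q)) J"
      using that Jt(2) unfolding A_def q by (intro mult_in_prod_space_of) auto
    then show ?thesis using p(1) unfolding A_def q by simp
  qed
  \<comment> \<open>From \<open>Jt J = 0\<close> and \<open>A = ?L m\<close> follows
    \<open>A J \<subseteq> ?M\<close>. Were \<open>?M + J\<close> all of \<open>A\<close>, every
    product would lie in \<open>?M\<close>, against \<open>A^2 = A\<close>; so maximality gives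
    \<open>?M + J = ?M\<close>.\<close>
  have JM: "J \<subseteq> ?M"
  proof -
    have prod: "x * y \<in> ?M" if "y \<in> ?M + J" for x y
    proof -
      obtain b c where y: "y = b + c" "b \<in> ?M" "c \<in> J" using \<open>y \<in> ?M + J\<close> by (auto elim!: set_plus_elim)
      have "x * c \<in> ?M"
        using layers_mult_right_zero[OF U Jinv JtJ _ y(3), of x "m - 1"] Lm m1 by simp
      then show ?thesis using y Linv[of "m - 1"] unfolding inv_ideal_of by (simp add: distrib_left)
    qed
    have "?M + J \<noteq> UNIV"
    proof
      assume "?M + J = UNIV"
      then have "x * y \<in> ?M" for x y using prod by simp
      then show False using inv_simple_mult_closed[OF simple Linv] Mne by blast
    qed
    moreover have "?M \<subseteq> ?M + J" "J \<subseteq> ?M + J"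
      using Jinv Linv[of "m - 1"] unfolding inv_ideal_of
      by (metis add.right_neutral set_plus_intro subsetI, metis add.left_neutral set_plus_intro subsetI)
    ultimately show ?thesis using Mmax[OF inv_ideal_plus[OF Linv Jinv]] by blast
  qed
  \<comment> \<open>\<open>M\<close> annihilates \<open>A / M\<close>, which is a twisted copy of \<open>Jt\<close>.\<close>
  have JtM: "a * c = 0" if a: "a \<in> Jt" and c: "c \<in> ?M" for a c
  proof (rule inj)
    let ?x = "act (v ^ (m - 1)) a * act (g2 ^ (m - 1)) c"
    have "act (g2 ^ (m - 1)) c \<in> ?M"
      using Linv[of "m - 1"] c power_in[OF g2(1)] unfolding inv_ideal_of by blast
    then have "?x \<in> ?M" using Linv[of "m - 1"] unfolding inv_ideal_of by blast
    moreover have "act (v ^ (m - 1)) (a * c) - ?x \<in> ?M" by (rule twist_right[OF U a])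
    ultimately have "act (v ^ (m - 1)) (a * c) - ?x + ?x \<in> ?M"
      using Linv[of "m - 1"] unfolding inv_ideal_of by blast
    then show "act (v ^ (m - 1)) (a * c) \<in> ?M" by simp
  qed (use m1 a Ud in auto)
  \<comment> \<open>Each right multiplication by \<open>?M\<close> descends one layer because
    \<open>Jt\<close> annihilates \<open>?M\<close>. With truncated subtraction the bound stays at
    layer 0, which is \<open>{0}\<close>, once \<open>n\<close> reaches
    \<open>m - 1\<close>.\<close>
  have pow: "ideal_power AA ?M (Suc n) \<subseteq> ?L (m - 1 - n)" for n
  proof (induction n)
    case (Suc n)
    have "prod_space AA (ideal_power AA ?M (Suc n)) ?M \<subseteq> ?L (m - 1 - Suc n)"
    proof (rule prod_space_of_subset)
      show "is_subspace AA (?L (m - 1 - Suc n))"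
        using Linv unfolding inv_ideal_def by blast
      fix x y assume "x \<in> ideal_power AA ?M (Suc n)" and y: "y \<in> ?M"
      then have x: "x \<in> ?L (m - 1 - n)" using Suc by blast
      moreover have "m - 1 - n \<le> Suc (m - 1 - Suc n)" by arith
      ultimately have "x \<in> ?L (Suc (m - 1 - Suc n))"
        using layers_mono[OF U, of "m - 1 - n" "Suc (m - 1 - Suc n)"] by blast
      then show "x * y \<in> ?L (m - 1 - Suc n)"
        using layers_mult_right_zero[OF U Linv JtM _ y] by blast
    qed
    then show ?case by simp
  qed simp
  have zin: "0 \<in> ideal_power AA ?M m"
  proof -
    obtain n where n: "m = Suc n" using m1 by (cases m) auto
    show ?thesis using Linv[of n] is_subspace_prod_space_of[of scaleA act]
      unfolding n by (cases n) (auto simp: inv_ideal_of is_subspace_of)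
  qed
  have "nilpotent_ideal AA ?M"
  proof -
    have "ideal_power AA ?M m \<subseteq> {0}" using pow[of "m - 1"] m1 by (simp add: layers_0)
    then have "ideal_power AA ?M m = {0}" using zin by blast
    then show ?thesis using m1 unfolding nilpotent_ideal_def by auto
  qed
  then have MJ: "?M = J" using Jmax[OF Linv _ JM] by blast
  \<comment> \<open>In a vanishing sum the top term is minus the sum of the others, so it lies in
    \<open>?L k\<close> and \<open>inj\<close> makes it zero; the induction hypothesis treats the
    rest.\<close>
  have direct: "sum_is_direct k (\<lambda>i. act (v ^ i) ` Jt)" if "k \<le> m" for k
    unfolding sum_is_direct_def
  proof (intro allI impI)
    fix a :: "nat \<Rightarrow> 'a" and i
    assume "(\<forall>i<k. a i \<in> act (v ^ i) ` Jt) \<and> (\<Sum>i<k. a i) = 0" "i < k"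
    then show "a i = 0" using that
    proof (induction k)
      case (Suc k)
      let ?s = "\<Sum>i<k. a i"
      obtain b where b: "b \<in> Jt" "a k = act (v ^ k) b" using Suc.prems by auto
      have "?s \<in> ?L k"
        unfolding layers_def set_sum_alt[OF finite_lessThan] using Suc.prems by auto
      moreover have s: "a k = - ?s" using Suc.prems by (simp add: add_eq_0_iff2)
      ultimately have "a k \<in> ?L k" using inv_ideal_uminus[OF Linv] by simp
      then have "b = 0" using inj[of k b] b Suc.prems by simp
      then have ak: "a k = 0" using b by (simp add: act_zero)
      then show ?case using Suc s by (cases "i = k") auto
    qed simp
  qed
  have bij: "bij_betw (act v) (act (v ^ k) ` Jt) (act (v ^ (k + 1)) ` Jt)" if "k + 2 \<le> m" for k
    unfolding bij_betw_def
  proof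
    show "inj_on (act v) (act (v ^ k) ` Jt)"
    proof (rule inj_onI, elim imageE)
      fix x y a b assume e: "act v x = act v y" "x = act (v ^ k) a" "y = act (v ^ k) b"
        and ab: "a \<in> Jt" "b \<in> Jt"
      have "act (v ^ (k + 1)) (a - b) = 0" using e by (simp add: act_mult act_diff)
      then have "a - b = 0"
        using inj[of "k + 1" "a - b"] that inv_ideal_diff[OF U ab] Linv[of "k + 1"]
        by (simp add: inv_ideal_of)
      then show "x = y" using e by simp
    qed
  qed (simp add: image_image act_mult)
  have "inv_simple (quotient_alg AA J) Ht"
  proof (rule inv_simple_quotient[OF Jinv])
    show "L = J \<or> L = UNIV" if "inv_ideal AA Ht L" "J \<subseteq> L" for L using Mmax that MJ by blast
    show "\<not> (\<forall>x y. x * y \<in> J)" using inv_simple_mult_closed[OF simple Jinv] Mne MJ by blast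
  qed
  then show ?thesis
    unfolding A_def using m1 direct Linv Lm MJ bij act_linear unfolding layers_def by blast
qed

end
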